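(* Let $2\le m<n$ be integers satisfying $(m-1)\mid(n-1)$, with $(n-1)=(m-1)d$. Then there is a monomorphism $\lambda_{n,m}:F_{n,0}\to F_{m,0}$ with $g_{n,i}\lambda_{n,m}=g_{m,i}^{d}$ for each $i\ge 0$, and there is a monomorphism $\lambda'_{m,n}:F_{m,0}\to F_{n,0}$ with $g_{m,i}\lambda'_{m,n}=g_{n,di}$ for each $i\ge 0$.
   Context: Functions are written to the right of their arguments and composed from left to right. For integers $n\ge 2$ and $i$, $g_{n,i}$ is the self homeomorphism of $\mathbf{R}$ with $xg_{n,i}=x$ for $x<i$, $xg_{n,i}=n(x-i)+i$ for $i\le x\le i+1$, and $xg_{n,i}=x+n-1$ for $x>i+1$. $F_{n,0}$ is the subgroup of $\mathrm{Homeo}(\mathbf{R})$ generated by $g_{n,0},g_{n,1},g_{n,2},\dots$. *)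

theory Defs
  imports "HOL-Analysis.Analysis" "HOL-Algebra.Algebra"
begin

text \<open>Functions act on the right and are composed from left to right, so
  the product of \<open>f\<close> and \<open>h\<close> is ``first \<open>f\<close>, then \<open>h\<close>''.\<close>

definition Homeo :: "(real \<Rightarrow> real) monoid" where
  "Homeo = \<lparr>carrier = {f. \<exists>h. homeomorphism UNIV UNIV f h},
            monoid.mult = (\<lambda>f h. h \<circ> f),
            one = id\<rparr>"

definition g :: "int \<Rightarrow> int \<Rightarrow> real \<Rightarrow> real" where
  "g n i x =
    (if x < of_int i then x
     else if x \<le> of_int i + 1 then of_int n * (x - of_int i) + of_int i
     else x + of_int n - 1)"

text \<open>The library's \<open>subgroup_generated\<close> intersects the generating set with the
  carrier; by \<open>g_in_Homeo\<close> below this discards nothing for \<open>n \<ge> 2\<close>.\<close>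

definition F0 :: "int \<Rightarrow> (real \<Rightarrow> real) monoid" where
  "F0 n = subgroup_generated Homeo {g n i | i. i \<ge> 0}"

lemma group_Homeo: "Group.group Homeo"
proof (rule groupI)
  fix f h assume "f \<in> carrier Homeo" "h \<in> carrier Homeo"
  then show "f \<otimes>\<^bsub>Homeo\<^esub> h \<in> carrier Homeo"
    unfolding Homeo_def by (auto intro: homeomorphism_compose)
next
  show "\<one>\<^bsub>Homeo\<^esub> \<in> carrier Homeo"
    unfolding Homeo_def using homeomorphism_ident[of "UNIV :: real set"] by (auto simp: id_def)
next
  fix f assume "f \<in> carrier Homeo"
  then obtain h where h: "homeomorphism UNIV UNIV f h"
    by (auto simp: Homeo_def)
  then have "h \<in> carrier Homeo" "h \<otimes>\<^bsub>Homeo\<^esub> f = \<one>\<^bsub>Homeo\<^esub>"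
    using homeomorphism_sym[of UNIV UNIV f h]
    by (auto simp: Homeo_def homeomorphism_def fun_eq_iff)
  then show "\<exists>h\<in>carrier Homeo. h \<otimes>\<^bsub>Homeo\<^esub> f = \<one>\<^bsub>Homeo\<^esub>"
    by blast
qed (auto simp: Homeo_def comp_assoc)

lemma g_altdef:
  assumes "n \<ge> 1"
  shows "g n i x = x + of_int (n - 1) * max 0 (min 1 (x - of_int i))"
  by (auto simp: g_def algebra_simps max_def min_def)

lemma g_in_Homeo:
  assumes "n \<ge> 2"
  shows "g n i \<in> carrier Homeo"
proof -
  let ?c = "of_int (n - 1) :: real"
  let ?h = "\<lambda>y. y - ?c / of_int n * max 0 (min (of_int n) (y - of_int i))"
  have n: "of_int n \<ge> (2::real)"
    using assms by linarith
  have eq: "g n i = (\<lambda>x. x + ?c * max 0 (min 1 (x - of_int i)))"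
    using assms by (auto simp: g_altdef)
  let ?k = "\<lambda>y. if y < of_int i then y
     else if y \<le> of_int i + of_int n then (y - of_int i) / of_int n + of_int i
     else y - of_int n + 1"
  have h: "?h y = ?k y" for y
    using n by (auto simp: max_def min_def field_simps)
  have "?h (g n i x) = x" for x
  proof -
    consider "x < of_int i" | "of_int i \<le> x" "x \<le> of_int i + 1" | "of_int i + 1 < x"
      by linarith
    then have "?k (g n i x) = x"
    proof cases
      case 2
      define p where "p = of_int n * (x - of_int i)"
      have "0 \<le> p"
        unfolding p_def using 2 n by (intro mult_nonneg_nonneg) auto
      moreover have "p \<le> of_int n * 1"
        unfolding p_def using 2 n by (intro mult_left_mono) auto
      moreover have "g n i x = p + of_int i"
        using 2 by (simp add: g_def p_def)
      moreover have "p / of_int n = x - of_int i"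
        using n by (simp add: p_def)
      ultimately show ?thesis
        by simp
    qed (use n in \<open>auto simp: g_def\<close>)
    then show ?thesis
      by (simp only: h)
  qed
  moreover have "g n i (?h y) = y" for y
  proof -
    consider "y < of_int i" | "of_int i \<le> y" "y \<le> of_int i + of_int n" | "of_int i + of_int n < y"
      by linarith
    then have "g n i (?k y) = y"
    proof cases
      case 2
      define q where "q = (y - of_int i) / of_int n"
      have "0 \<le> q" "q \<le> 1" "of_int n * q = y - of_int i"
        using 2 n by (auto simp: q_def)
      moreover have "?k y = q + of_int i"
        using 2 by (simp add: q_def)
      ultimately show ?thesis
        by (simp add: g_def)
    qed (use n in \<open>auto simp: g_def\<close>)
    then show ?thesis
      by (simp only: h)
  qed
  moreover have "continuous_on UNIV (g n i)"
    unfolding eq by (intro continuous_intros)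
  moreover have "continuous_on UNIV ?h"
    using n by (intro continuous_intros) auto
  ultimately have "homeomorphism UNIV UNIV (g n i) ?h"
    by (intro homeomorphismI) auto
  then show ?thesis
    by (auto simp: Homeo_def)
qed

end

theory Submission
  imports Defs
begin

text \<open>Products are written in the order in which the functions act. If \<open>i < j\<close>, then \<open>g n i\<close> is
  translation by \<open>n - 1\<close> on the half-line that contains the support \<open>{j<..}\<close> of \<open>g n j\<close>, so
  conjugation by \<open>g n i\<close> carries \<open>g n j\<close> to \<open>g n (j + n - 1)\<close>. Iterating, the elements
  \<open>g n (c * i)\<close> raised to the power \<open>e\<close> satisfy the relations
  \<open>a j \<otimes> a i = a i \<otimes> a (j + k)\<close> for \<open>i < j\<close> as soon as \<open>c * k = e * (n - 1)\<close>. Because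
  \<open>n - 1 = (m - 1) * d\<close>, the generators \<open>g n i\<close> and the powers of \<open>g m i\<close> with exponent \<open>d\<close>
  satisfy these relations for the same shift \<open>k = n - 1\<close>, and the generators \<open>g m i\<close> and the
  elements \<open>g n (d * i)\<close> satisfy them for the same shift \<open>k = m - 1\<close>.

  It remains to see that two such families \<open>a\<close> and \<open>b\<close> generate isomorphic groups, without
  first knowing that the relations present the group. The relations alone have two consequences:
  every positive word equals a sorted one (\<open>sorted_word_exists\<close>), and any two positive words
  have a common right multiple (\<open>word_common_multiple\<close>). Hence every element of the generated
  group is a fraction \<open>u v\<^sup>-\<^sup>1\<close> of sorted words (\<open>generate_sorted_fraction\<close>). This also holds for
  the family of pairs \<open>(a i, b i)\<close> in the direct product, so in the subgroup generated by
  these pairs both coordinates of an element are given by the same \<open>u\<close> and \<open>v\<close>. If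
  distinct sorted words have distinct values in either group, then each coordinate is trivial
  exactly when \<open>u = v\<close>, and therefore this subgroup is the graph of an injective homomorphism
  (\<open>shift_family_monomorphism\<close>).

  Distinct sorted words do have distinct values (\<open>sorted_word_prod_inj\<close>): the letters move no
  point to the left, and the support of a letter shrinks as its index grows, so the first letter
  of a sorted word can be read off from the set of points that the word fixes.\<close>

section \<open>Words and fractions in groups with shift relations\<close>

primrec word_prod :: "('a, 'b) monoid_scheme \<Rightarrow> (nat \<Rightarrow> 'a) \<Rightarrow> nat list \<Rightarrow> 'a" where
  "word_prod G a [] = \<one>\<^bsub>G\<^esub>"
| "word_prod G a (i # w) = a i \<otimes>\<^bsub>G\<^esub> word_prod G a w"

text \<open>The relations of the groups \<open>F0 n\<close>, where \<open>k = n - 1\<close>, stated for an arbitrary group so that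
  they can be used for subfamilies, for powers and in a direct product.\<close>

locale shift_family = group G for G (structure) +
  fixes a :: "nat \<Rightarrow> 'a" and k :: nat
  assumes closed [simp, intro]: "a i \<in> carrier G"
    and shift: "i < j \<Longrightarrow> a j \<otimes> a i = a i \<otimes> a (j + k)"
begin

lemma word_prod_closed [simp, intro]: "word_prod G a w \<in> carrier G"
  by (induction w) auto

lemma word_prod_append: "word_prod G a (u @ v) = word_prod G a u \<otimes> word_prod G a v"
  by (induction u) (auto simp: m_assoc)

text \<open>A letter moves to the right past a smaller one at the cost of raising its index by \<open>k\<close>.
  The lower bound \<open>l\<close> is carried through the induction so that the smaller letter may
  afterwards be put back in front of the sorted remainder.\<close>

lemma insert_letter_sorted:
  assumes "sorted w" "\<forall>i\<in>set w. l \<le> i" "l \<le> j"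
  shows "\<exists>w'. sorted w' \<and> (\<forall>i\<in>set w'. l \<le> i) \<and> a j \<otimes> word_prod G a w = word_prod G a w'"
  using assms
proof (induction w arbitrary: j l)
  case Nil
  then show ?case by (intro exI[of _ "[j]"]) auto
next
  case (Cons i w)
  show ?case
  proof (cases "j \<le> i")
    case True
    with Cons.prems show ?thesis by (intro exI[of _ "j # i # w"]) auto
  next
    case False
    obtain w' where w': "sorted w'" "\<forall>i'\<in>set w'. i \<le> i'"
      "a (j + k) \<otimes> word_prod G a w = word_prod G a w'"
      using Cons.IH[of i "j + k"] Cons.prems False by auto
    have "a j \<otimes> word_prod G a (i # w) = (a j \<otimes> a i) \<otimes> word_prod G a w"
      by (simp add: m_assoc)
    also have "\<dots> = a i \<otimes> word_prod G a w'"
      using False by (simp add: shift m_assoc w'(3))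
    finally show ?thesis
      using w' Cons.prems by (intro exI[of _ "i # w'"]) auto
  qed
qed

lemma sorted_word_exists: "\<exists>w'. sorted w' \<and> word_prod G a w = word_prod G a w'"
proof (induction w)
  case Nil
  then show ?case by (intro exI[of _ "[]"]) auto
next
  case (Cons i w)
  then obtain w' where "sorted w'" "word_prod G a w = word_prod G a w'"
    by auto
  then show ?case
    using insert_letter_sorted[of w' 0 i] by auto
qed

text \<open>The relation for two distinct letters is a commuting square
  \<open>a i \<otimes> a j' = a j \<otimes> a i'\<close>. Such squares are pasted side by side along the word \<open>v\<close>.\<close>

lemma letter_common_multiple:
  "\<exists>u w. a i \<otimes> word_prod G a u = word_prod G a v \<otimes> word_prod G a w"
proof (induction v arbitrary: i)
  case Nil
  show ?case by (intro exI[of _ "[]"] exI[of _ "[i]"]) auto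
next
  case (Cons j v)
  show ?case
  proof (cases "i = j")
    case True
    then show ?thesis by (intro exI[of _ v] exI[of _ "[]"]) auto
  next
    case False
    obtain i' j' where sq: "a i \<otimes> a j' = a j \<otimes> a i'"
      using False shift[of i j] shift[of j i] by (metis linorder_neqE_nat)
    obtain u w where uw: "a i' \<otimes> word_prod G a u = word_prod G a v \<otimes> word_prod G a w"
      using Cons.IH by blast
    have "a i \<otimes> word_prod G a (j' # u) = (a i \<otimes> a j') \<otimes> word_prod G a u"
      by (simp add: m_assoc)
    also have "\<dots> = word_prod G a (j # v) \<otimes> word_prod G a w"
      by (simp add: sq m_assoc uw)
    finally show ?thesis by blast
  qed
qed

text \<open>The Ore condition. It turns \<open>v\<^sup>-\<^sup>1 u\<close> into \<open>v' u'\<^sup>-\<^sup>1\<close>, which is what makes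
  the set of fractions closed under multiplication.\<close>

lemma word_common_multiple:
  "\<exists>u' v'. word_prod G a u \<otimes> word_prod G a u' = word_prod G a v \<otimes> word_prod G a v'"
proof (induction u arbitrary: v)
  case Nil
  show ?case by (intro exI[of _ v] exI[of _ "[]"]) auto
next
  case (Cons i u)
  obtain v1 w where 1: "a i \<otimes> word_prod G a v1 = word_prod G a v \<otimes> word_prod G a w"
    using letter_common_multiple by blast
  obtain u' v' where 2: "word_prod G a u \<otimes> word_prod G a u' = word_prod G a v1 \<otimes> word_prod G a v'"
    using Cons.IH by blast
  have "word_prod G a (i # u) \<otimes> word_prod G a u' = (a i \<otimes> word_prod G a v1) \<otimes> word_prod G a v'"
    by (simp add: m_assoc 2)
  also have "\<dots> = word_prod G a v \<otimes> word_prod G a (w @ v')"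
    by (simp add: 1 m_assoc word_prod_append)
  finally show ?case by blast
qed

lemma generate_fraction:
  assumes "x \<in> generate G (range a)"
  shows "\<exists>u v. x = word_prod G a u \<otimes> inv (word_prod G a v)"
  using assms
proof induction
  case one
  show ?case by (intro exI[of _ "[]"]) auto
next
  case (incl x)
  then obtain i where "x = a i" by auto
  then show ?case by (intro exI[of _ "[i]"] exI[of _ "[]"]) auto
next
  case (inv x)
  then obtain i where "x = a i" by auto
  then show ?case by (intro exI[of _ "[]"] exI[of _ "[i]"]) auto
next
  case (eng x y)
  let ?P = "word_prod G a"
  obtain u v u' v' where xy: "x = ?P u \<otimes> inv (?P v)" "y = ?P u' \<otimes> inv (?P v')"
    using eng.IH by blast
  obtain s t where st: "?P v \<otimes> ?P s = ?P u' \<otimes> ?P t"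
    using word_common_multiple by blast
  have Pu': "?P u' = ?P v \<otimes> (?P s \<otimes> inv (?P t))"
    by (simp add: st flip: m_assoc) (simp add: m_assoc)
  have "x \<otimes> y = ?P u \<otimes> (inv (?P v) \<otimes> ?P u') \<otimes> inv (?P v')"
    by (simp add: xy m_assoc)
  also have "inv (?P v) \<otimes> ?P u' = ?P s \<otimes> inv (?P t)"
    unfolding Pu' by (simp flip: m_assoc)
  also have "?P u \<otimes> (?P s \<otimes> inv (?P t)) \<otimes> inv (?P v') = ?P (u @ s) \<otimes> inv (?P (v' @ t))"
    by (simp add: word_prod_append m_assoc inv_mult_group)
  finally show ?case by blast
qed

lemma generate_sorted_fraction:
  assumes "x \<in> generate G (range a)"
  obtains u v where "sorted u" "sorted v" "x = word_prod G a u \<otimes> inv (word_prod G a v)"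
  using generate_fraction[OF assms] sorted_word_exists by metis

end

section \<open>Comparing two families with the same shift\<close>

lemma word_prod_DirProd:
  "word_prod (G \<times>\<times> H) (\<lambda>i. (a i, b i)) w = (word_prod G a w, word_prod H b w)"
  by (induction w) auto

lemma generate_DirProd_lift:
  assumes "group G" "group H" "range a \<subseteq> carrier G" "range b \<subseteq> carrier H"
    and "x \<in> generate G (range a)"
  shows "\<exists>y. (x, y) \<in> generate (G \<times>\<times> H) (range (\<lambda>i. (a i, b i)))"
  using assms(5)
proof induction
  case one
  show ?case using generate.one[of "G \<times>\<times> H"] by auto
next
  case (incl x)
  then show ?case using generate.incl[of _ "range (\<lambda>i. (a i, b i))" "G \<times>\<times> H"] by fast
next
  case (inv x)
  then obtain i where "x = a i" by auto
  moreover have "inv\<^bsub>G \<times>\<times> H\<^esub> (a i, b i) = (inv\<^bsub>G\<^esub> (a i), inv\<^bsub>H\<^esub> (b i))"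
    using assms by (intro inv_DirProd) auto
  ultimately show ?case
    using generate.inv[of "(a i, b i)" "range (\<lambda>i. (a i, b i))" "G \<times>\<times> H"] by auto
next
  case (eng x x')
  then show ?case using generate.eng[of _ "G \<times>\<times> H"] by fastforce
qed

text \<open>The homomorphism is obtained from its graph, the subgroup \<open>R\<close> of the direct product generated
  by the pairs \<open>(a i, b i)\<close>. Since \<open>R\<close> is a subgroup, it is the graph of an injective
  function once its elements with one trivial coordinate are known to be trivial. Writing
  an element of \<open>R\<close> as a fraction of sorted words \<open>u\<close> and \<open>v\<close> in the pairs turns triviality
  of either coordinate into the equation \<open>u = v\<close>.\<close>

theorem shift_family_monomorphism:
  assumes a: "shift_family G a k" and b: "shift_family H b k"
    and inj_a: "inj_on (word_prod G a) {w. sorted w}"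
    and inj_b: "inj_on (word_prod H b) {w. sorted w}"
    and gen: "carrier G = generate G (range a)"
  shows "\<exists>\<phi> \<in> mon G H. \<forall>i. \<phi> (a i) = b i"
proof -
  interpret A: shift_family G a k by fact
  interpret B: shift_family H b k by fact
  let ?c = "\<lambda>i. (a i, b i)"
  interpret P: group "G \<times>\<times> H" by (rule DirProd_group) unfold_locales
  interpret C: shift_family "G \<times>\<times> H" ?c k
    by unfold_locales (auto simp: A.shift B.shift)
  define R where "R = generate (G \<times>\<times> H) (range ?c)"
  have R: "subgroup R (G \<times>\<times> H)"
    unfolding R_def by (intro P.generate_is_subgroup) auto
  have R_carrier: "x \<in> carrier G" "y \<in> carrier H" if "(x, y) \<in> R" for x y
    using subgroup.subset[OF R] that by auto
  have R_mult: "(x \<otimes>\<^bsub>G\<^esub> x', y \<otimes>\<^bsub>H\<^esub> y') \<in> R" if "(x, y) \<in> R" "(x', y') \<in> R" for x y x' y'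
    using subgroup.m_closed[OF R that] by simp
  have R_inv: "(inv\<^bsub>G\<^esub> x, inv\<^bsub>H\<^esub> y) \<in> R" if "(x, y) \<in> R" for x y
    using subgroup.m_inv_closed[OF R that] R_carrier[OF that]
    by (simp add: A.is_group B.is_group)
  have R_one: "x = \<one>\<^bsub>G\<^esub> \<longleftrightarrow> y = \<one>\<^bsub>H\<^esub>" if xy: "(x, y) \<in> R" for x y
  proof -
    obtain u v where uv: "sorted u" "sorted v"
      "(x, y) = word_prod (G \<times>\<times> H) ?c u \<otimes>\<^bsub>G \<times>\<times> H\<^esub> inv\<^bsub>G \<times>\<times> H\<^esub> (word_prod (G \<times>\<times> H) ?c v)"
      using C.generate_sorted_fraction[OF xy[unfolded R_def]] by blast
    then have x: "x = word_prod G a u \<otimes>\<^bsub>G\<^esub> inv\<^bsub>G\<^esub> (word_prod G a v)"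
      and y: "y = word_prod H b u \<otimes>\<^bsub>H\<^esub> inv\<^bsub>H\<^esub> (word_prod H b v)"
      by (auto simp: word_prod_DirProd A.is_group B.is_group)
    have "x = \<one>\<^bsub>G\<^esub> \<longleftrightarrow> word_prod G a u = word_prod G a v"
      unfolding x by (simp add: A.inv_solve_right')
    also have "\<dots> \<longleftrightarrow> u = v"
      using inj_onD[OF inj_a] uv by auto
    also have "\<dots> \<longleftrightarrow> word_prod H b u = word_prod H b v"
      using inj_onD[OF inj_b] uv by auto
    also have "\<dots> \<longleftrightarrow> y = \<one>\<^bsub>H\<^esub>"
      unfolding y by (simp add: B.inv_solve_right')
    finally show ?thesis .
  qed
  have R_bij: "x = x' \<longleftrightarrow> y = y'" if xy: "(x, y) \<in> R" "(x', y') \<in> R" for x y x' y'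
  proof -
    have "(x \<otimes>\<^bsub>G\<^esub> inv\<^bsub>G\<^esub> x', y \<otimes>\<^bsub>H\<^esub> inv\<^bsub>H\<^esub> y') \<in> R"
      by (intro R_mult R_inv xy)
    from R_one[OF this] show ?thesis
      using R_carrier[OF xy(1)] R_carrier[OF xy(2)]
      by (simp add: A.inv_solve_right' B.inv_solve_right')
  qed
  define \<phi> where "\<phi> x = (SOME y. (x, y) \<in> R)" for x
  have \<phi>: "(x, \<phi> x) \<in> R" if "x \<in> carrier G" for x
  proof -
    have "\<exists>y. (x, y) \<in> R"
      unfolding R_def using that gen
      by (intro generate_DirProd_lift) (auto simp: A.is_group B.is_group)
    then show ?thesis unfolding \<phi>_def by (rule someI_ex)
  qed
  have "\<phi> (x \<otimes>\<^bsub>G\<^esub> y) = \<phi> x \<otimes>\<^bsub>H\<^esub> \<phi> y" if "x \<in> carrier G" "y \<in> carrier G" for x y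
    using R_bij[OF \<phi> R_mult[OF \<phi> \<phi>], of "x \<otimes>\<^bsub>G\<^esub> y" x y] that by auto
  then have "\<phi> \<in> hom G H"
    using R_carrier(2)[OF \<phi>] by (auto simp: hom_def)
  moreover have "inj_on \<phi> (carrier G)"
    using R_bij[OF \<phi> \<phi>] by (auto simp: inj_on_def)
  moreover have "\<phi> (a i) = b i" for i
  proof -
    have "(a i, b i) \<in> R" unfolding R_def by (rule generate.incl) auto
    then show ?thesis using R_bij[OF \<phi>] by blast
  qed
  ultimately show ?thesis by (auto simp: mon_def)
qed

section \<open>Sorted words in homeomorphisms with nested supports\<close>

text \<open>Letters of index greater than \<open>i\<close> all fix \<open>p (Suc i)\<close>, whereas the letter \<open>i\<close> moves this point
  to the right and no later letter can bring it back. So two sorted words with the same value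
  begin with the same letter, which can be cancelled.\<close>

lemma sorted_word_prod_inj:
  fixes G :: "(real \<Rightarrow> real) monoid" and p :: "nat \<Rightarrow> real"
  assumes G: "group G" and mult: "monoid.mult G = (\<lambda>f h. h \<circ> f)" and one: "\<one>\<^bsub>G\<^esub> = id"
    and carrier: "\<And>i. a i \<in> carrier G"
    and ge: "\<And>i x. x \<le> a i x" and fixed_iff: "\<And>i x. a i x = x \<longleftrightarrow> x \<le> p i"
    and p: "strict_mono p"
  shows "inj_on (word_prod G a) {w. sorted w}"
proof -
  interpret group G by fact
  have closed: "word_prod G a w \<in> carrier G" for w
    by (induction w) (auto simp: carrier)
  have Cons: "word_prod G a (i # w) x = word_prod G a w (a i x)" for i w x
    by (simp add: mult)
  have word_ge: "x \<le> word_prod G a w x" for w x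
  proof (induction w arbitrary: x)
    case (Cons i w)
    then show ?case using ge order_trans by (fastforce simp: mult)
  qed (simp add: one)
  have word_fix: "word_prod G a w x = x" if "\<forall>j\<in>set w. x \<le> p j" for w x
    using that by (induction w) (auto simp: one mult iffD2[OF fixed_iff])
  have differ: "word_prod G a (i # u) \<noteq> word_prod G a v" if "\<forall>j\<in>set v. i < j" for i u v
  proof -
    have "p (Suc i) \<le> p j" if "i < j" for j
      using that p by (simp add: strict_mono_less_eq Suc_leI)
    with that have "word_prod G a v (p (Suc i)) = p (Suc i)"
      by (intro word_fix) auto
    moreover have "p (Suc i) < a i (p (Suc i))"
      using ge[of "p (Suc i)" i] fixed_iff[of i "p (Suc i)"] strict_monoD[OF p, of i "Suc i"] by simp
    moreover have "a i (p (Suc i)) \<le> word_prod G a (i # u) (p (Suc i))"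
      unfolding Cons by (rule word_ge)
    ultimately show ?thesis by force
  qed
  have "u = v" if "sorted u" "sorted v" "word_prod G a u = word_prod G a v" for u v
    using that
  proof (induction u arbitrary: v)
    case Nil
    then show ?case using differ[of "[]"] by (cases v) auto
  next
    case (Cons i u)
    then obtain j v' where v: "v = j # v'"
      using differ[of "[]" i u] by (cases v) auto
    have "i = j"
    proof (rule linorder_cases)
      assume "i < j"
      then have "\<forall>x\<in>set v. i < x" using Cons.prems(2) by (auto simp: v)
      then show ?thesis using differ Cons.prems(3) by metis
    next
      assume "j < i"
      then have "\<forall>x\<in>set (i # u). j < x" using Cons.prems(1) by auto
      then show ?thesis using differ Cons.prems(3) unfolding v by metis
    qed
    moreover have "word_prod G a u = word_prod G a v'"
      using Cons.prems(3) \<open>i = j\<close> carrier[of i] closed by (simp add: v)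
    ultimately show ?case using Cons v by auto
  qed
  then show ?thesis by (auto intro!: inj_onI)
qed

section \<open>The generators of the groups F0\<close>

lemma g_ge: "n \<ge> 1 \<Longrightarrow> x \<le> g n i x"
  by (simp add: g_altdef)

lemma g_fixed_iff: "n \<ge> 2 \<Longrightarrow> g n i x = x \<longleftrightarrow> x \<le> of_int i"
  by (auto simp: g_altdef max_def min_def)

text \<open>On \<open>{..i + 1}\<close> the map \<open>g n j\<close> is the identity, and \<open>g n i\<close> sends this half-line to
  \<open>{..i + n}\<close>, where \<open>g n (j + n - 1)\<close> is the identity. Beyond \<open>i + 1\<close>, \<open>g n i\<close> is translation
  by \<open>n - 1\<close>.\<close>

lemma g_conjugation:
  assumes "n \<ge> 1" "i < j"
  shows "g n i (g n j x) = g n (j + n - 1) (g n i x)"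
proof (cases "x \<le> of_int i + 1")
  case True
  have ij: "of_int i + 1 \<le> (of_int j :: real)" using assms(2) by linarith
  have "g n j x = x"
    using assms(1) True ij by (simp add: g_altdef)
  moreover have "g n (j + n - 1) y = y" if "y \<le> of_int i + of_int n" for y
    using assms(1) ij that by (simp add: g_altdef)
  moreover have "g n i x \<le> of_int i + of_int n"
  proof -
    have "of_int (n - 1) * max 0 (min 1 (x - of_int i)) \<le> of_int (n - 1) * (1 :: real)"
      using assms(1) by (intro mult_left_mono) auto
    then show ?thesis using assms(1) True by (simp add: g_altdef)
  qed
  ultimately show ?thesis by simp
next
  case False
  have far: "g n i y = y + of_int (n - 1)" if "y > of_int i + 1" for y
    using assms(1) that by (simp add: g_altdef)
  have "g n j x > of_int i + 1"
    using g_ge[OF assms(1), of x j] False by linarith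
  then show ?thesis
    using False assms(1) by (simp add: far) (simp add: g_altdef algebra_simps)
qed

lemma group_F0: "group (F0 n)"
  unfolding F0_def by (rule group.group_subgroup_generated[OF group_Homeo])

lemma mult_F0: "monoid.mult (F0 n) = (\<lambda>f h. h \<circ> f)"
  by (simp add: F0_def Homeo_def subgroup_generated_def)

lemma one_F0: "\<one>\<^bsub>F0 n\<^esub> = id"
  by (simp add: F0_def Homeo_def subgroup_generated_def)

lemma g_in_F0:
  assumes "n \<ge> 2" "i \<ge> 0"
  shows "g n i \<in> carrier (F0 n)"
  unfolding F0_def carrier_subgroup_generated
  using assms g_in_Homeo by (auto intro: generate.incl)

lemma F0_generated:
  assumes "n \<ge> 2"
  shows "carrier (F0 n) = generate (F0 n) (range (\<lambda>i. g n (int i)))"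
proof -
  have S: "{g n i | i. i \<ge> 0} = range (\<lambda>i. g n (int i))"
    by (auto simp: image_iff) (metis nonneg_int_cases)
  then have gens: "carrier (F0 n) \<inter> {g n i | i. i \<ge> 0} = range (\<lambda>i. g n (int i))"
    using g_in_F0[OF assms] by auto
  have "carrier (F0 n) = carrier (subgroup_generated (F0 n) {g n i | i. i \<ge> 0})"
    unfolding F0_def by (simp only: group.subgroup_generated2[OF group_Homeo])
  also have "\<dots> = generate (F0 n) (range (\<lambda>i. g n (int i)))"
    by (simp only: carrier_subgroup_generated gens)
  finally show ?thesis .
qed

text \<open>Each factor \<open>x i\<close> that passes a power of \<open>x j\<close> shifts its index by \<open>s\<close>, whatever the exponent
  of that power is. So the total shift \<open>e * s\<close> depends only on the exponent of \<open>x i\<close>.\<close>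

lemma (in monoid) pow_shift:
  fixes x :: "int \<Rightarrow> 'a"
  assumes [simp, intro]: "\<And>i. 0 \<le> i \<Longrightarrow> x i \<in> carrier G" and "0 \<le> s" "0 \<le> i" "i < j"
    and shift: "\<And>i j. 0 \<le> i \<Longrightarrow> i < j \<Longrightarrow> x j \<otimes> x i = x i \<otimes> x (j + s)"
  shows "x j [^] (r::nat) \<otimes> x i [^] (e::nat) = x i [^] e \<otimes> x (j + int e * s) [^] r"
proof -
  have one: "x j [^] r \<otimes> x i = x i \<otimes> x (j + s) [^] r" if "i < j" for j
    using that assms(2,3)
  proof (induction r)
    case (Suc r)
    then show ?case by (simp add: m_assoc shift) (simp flip: m_assoc)
  qed auto
  show ?thesis
  proof (induction e)
    case (Suc e)
    have "0 \<le> int e * s" using assms(2) by simp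
    then have c: "0 \<le> j + int e * s" "i < j + int e * s" "0 \<le> j" "0 \<le> j + int e * s + s"
      using assms(2-4) by linarith+
    have "x j [^] r \<otimes> x i [^] Suc e = (x j [^] r \<otimes> x i [^] e) \<otimes> x i"
      using assms(3) c by (simp add: m_assoc)
    also have "\<dots> = x i [^] e \<otimes> (x (j + int e * s) [^] r \<otimes> x i)"
      using assms(3) c by (simp add: Suc m_assoc)
    also have "\<dots> = x i [^] Suc e \<otimes> x (j + int (Suc e) * s) [^] r"
      using assms(3) c by (simp add: one m_assoc algebra_simps)
    finally show ?case .
  qed (use assms in auto)
qed

lemma F0_pow_apply: "f [^]\<^bsub>F0 n\<^esub> (e::nat) = f ^^ e"
  by (induction e) (simp_all add: mult_F0 one_F0)

text \<open>One two-parameter family covers all cases: \<open>c = e = 1\<close> gives the generators themselves,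
  \<open>c = 1\<close> their powers, and \<open>e = 1\<close> the generators with index divisible by \<open>c\<close>.\<close>

definition thompson_family :: "int \<Rightarrow> nat \<Rightarrow> nat \<Rightarrow> nat \<Rightarrow> real \<Rightarrow> real" where
  "thompson_family n c e i = g n (int (c * i)) [^]\<^bsub>F0 n\<^esub> e"

text \<open>Raising to the power \<open>e\<close> multiplies the shift by \<open>e\<close>, and passing to multiples of \<open>c\<close>
  divides it by \<open>c\<close>.\<close>

lemma thompson_family_shift:
  assumes "n \<ge> 2" "c \<ge> 1" "int (c * k) = int e * (n - 1)"
  shows "shift_family (F0 n) (thompson_family n c e) k"
proof -
  interpret group "F0 n" by (rule group_F0)
  show ?thesis
  proof
    show "thompson_family n c e i \<in> carrier (F0 n)" for i
      unfolding thompson_family_def using assms by (intro nat_pow_closed g_in_F0) auto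
    show "thompson_family n c e j \<otimes>\<^bsub>F0 n\<^esub> thompson_family n c e i
      = thompson_family n c e i \<otimes>\<^bsub>F0 n\<^esub> thompson_family n c e (j + k)" if "i < j" for i j
    proof -
      have "int (c * (j + k)) = int (c * j) + int e * (n - 1)"
        using assms(3) by (simp only: distrib_left of_nat_add)
      moreover have "int (c * i) < int (c * j)"
        using assms(2) that by simp
      moreover have "g n j' \<otimes>\<^bsub>F0 n\<^esub> g n i' = g n i' \<otimes>\<^bsub>F0 n\<^esub> g n (j' + (n - 1))" if "i' < j'" for i' j'
        using g_conjugation[of n i' j'] assms(1) that by (auto simp: mult_F0 fun_eq_iff algebra_simps)
      ultimately show ?thesis
        unfolding thompson_family_def
        using pow_shift[of "g n" "n - 1" "int (c * i)" "int (c * j)" e e] g_in_F0 assms(1) by simp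
    qed
  qed
qed

text \<open>No orbit of \<open>g n i\<close> ever moves to the left, so a positive power fixes exactly the points
  that \<open>g n i\<close> fixes, and the supports of the family are the half-lines \<open>{c * i<..}\<close>.\<close>

lemma thompson_family_sorted_inj:
  assumes "n \<ge> 2" "c \<ge> 1" "e \<ge> 1"
  shows "inj_on (word_prod (F0 n) (thompson_family n c e)) {w. sorted w}"
proof (rule sorted_word_prod_inj[OF group_F0 mult_F0 one_F0])
  interpret group "F0 n" by (rule group_F0)
  let ?h = "\<lambda>i. g n (int (c * i))"
  have pow_ge: "x \<le> (?h i ^^ r) x" for i r x
  proof (induction r)
    case (Suc r)
    then show ?case using g_ge[of n "(?h i ^^ r) x" "int (c * i)"] assms(1) by simp
  qed auto
  show "thompson_family n c e i \<in> carrier (F0 n)" for i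
    unfolding thompson_family_def using assms by (intro nat_pow_closed g_in_F0) auto
  show "x \<le> thompson_family n c e i x" for i x
    unfolding thompson_family_def F0_pow_apply by (rule pow_ge)
  show "thompson_family n c e i x = x \<longleftrightarrow> x \<le> real (c * i)" for i x
  proof
    assume "x \<le> real (c * i)"
    then have "?h i x = x" using g_fixed_iff[OF assms(1)] by simp
    then have "(?h i ^^ r) x = x" for r by (induction r) auto
    then show "thompson_family n c e i x = x"
      by (simp add: thompson_family_def F0_pow_apply)
  next
    assume fixed: "thompson_family n c e i x = x"
    obtain r where "e = Suc r" using assms(3) by (cases e) auto
    then have "?h i x \<le> x"
      using fixed pow_ge[of "?h i x" r i]
      unfolding thompson_family_def F0_pow_apply by (simp add: funpow_swap1)
    then have "?h i x = x" using g_ge[of n x "int (c * i)"] assms(1) by simp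
    then show "x \<le> real (c * i)" using g_fixed_iff[OF assms(1)] by simp
  qed
  show "strict_mono (\<lambda>i. real (c * i))"
    using assms(2) by (auto simp: strict_mono_def)
qed

text \<open>The numerical condition says that the target family has shift \<open>n - 1\<close>, the shift of the
  generators of \<open>F0 n\<close>.\<close>

lemma thompson_family_monomorphism:
  assumes "n \<ge> 2" "m \<ge> 2" "c \<ge> 1" "e \<ge> 1" "int c * (n - 1) = int e * (m - 1)"
  shows "\<exists>\<phi> \<in> mon (F0 n) (F0 m). \<forall>i. \<phi> (g n (int i)) = g m (int (c * i)) [^]\<^bsub>F0 m\<^esub> e"
proof -
  have fam: "thompson_family n 1 1 = (\<lambda>i. g n (int i))"
    unfolding thompson_family_def F0_pow_apply by simp
  have "\<exists>\<phi> \<in> mon (F0 n) (F0 m). \<forall>i. \<phi> (thompson_family n 1 1 i) = thompson_family m c e i"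
    by (rule shift_family_monomorphism[OF thompson_family_shift thompson_family_shift
          thompson_family_sorted_inj thompson_family_sorted_inj, where k = "nat (n - 1)"])
      (use assms F0_generated[OF assms(1)] in \<open>simp_all only: fam, simp_all\<close>)
  then show ?thesis
    unfolding fam by (simp add: thompson_family_def)
qed

section \<open>The two monomorphisms\<close>

theorem proposition2p5p2:
  fixes m n d :: int
  assumes "2 \<le> m" and "m < n"
    and "(m - 1) dvd (n - 1)" and "n - 1 = (m - 1) * d"
  shows "(\<exists>\<phi> \<in> mon (F0 n) (F0 m). \<forall>i\<ge>0. \<phi> (g n i) = g m i [^]\<^bsub>F0 m\<^esub> d)
       \<and> (\<exists>\<psi> \<in> mon (F0 m) (F0 n). \<forall>i\<ge>0. \<psi> (g m i) = g n (d * i))"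
proof -
  have "0 < (m - 1) * d" using assms by linarith
  then have "d > 0" using assms(1) by (simp add: zero_less_mult_iff)
  then obtain e where e: "d = int e" "e \<ge> 1"
    by (metis One_nat_def Suc_leI of_nat_0_less_iff pos_int_cases)
  obtain \<phi> where \<phi>: "\<phi> \<in> mon (F0 n) (F0 m)" "\<And>i. \<phi> (g n (int i)) = g m (int i) [^]\<^bsub>F0 m\<^esub> e"
    using thompson_family_monomorphism[of n m 1 e] assms e by (auto simp: mult.commute)
  have "\<phi> (g n i) = g m i [^]\<^bsub>F0 m\<^esub> d" if "i \<ge> 0" for i
    using \<phi>(2)[of "nat i"] that e(1) by (simp add: int_pow_int)
  moreover obtain \<psi> where \<psi>: "\<psi> \<in> mon (F0 m) (F0 n)"
    "\<And>i. \<psi> (g m (int i)) = g n (int (e * i)) [^]\<^bsub>F0 n\<^esub> (1::nat)"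
    using thompson_family_monomorphism[of m n e 1] assms e by (auto simp: mult.commute)
  have "\<psi> (g m i) = g n (d * i)" if "i \<ge> 0" for i
    using \<psi>(2)[of "nat i"] that e(1) by (simp add: mult_F0 one_F0)
  ultimately show ?thesis using \<phi>(1) \<psi>(1) by blast
qed

end
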